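(* Let $\mathcal{B}$ be an arbitrary complete Boolean algebra, let $Q$ be the Stone space of $\mathcal{B}$ and let $X,Y$ be ideals in $C(Q)$. Then any band preserving derivation $\delta$ from $X$ into $Y$ is trivial, i.e. $\delta=0$.
   Context: $C(Q)$ is the algebra of all continuous real-valued functions on $Q$. $\mathcal{B}$ is identified with the Boolean algebra of idempotents of $C(Q)$ (characteristic functions of clopen sets); $\mathbf{1}$ is the constant function one. Support: for $x\in C(Q)$, $s(x)=\mathbf{1}-\sup\{e\in\mathcal{B}:ex=0\}\in\mathcal{B}$ (supremum in $\mathcal B$). An ideal in $C(Q)$ is a subalgebra $X\subset C(Q)$ with $xa\in X$ for all $x\in C(Q)$, $a\in X$. A derivation $\delta:X\to Y$ is a linear map with $\delta(xy)=\delta(x)y+x\delta(y)$ for all $x,y\in X$; it is band preserving if $s(\delta(x))\leqslant s(x)$ for all $x\in X$. *)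

theory Defs
  imports "HOL-Analysis.Analysis" "HOL-Library.Function_Algebras"
begin

text \<open>
  Complete Boolean algebras are types of sort \<open>{boolean_algebra, complete_lattice}\<close>. The class
  \<open>complete_boolean_algebra\<close> of the library demands complete distributivity and therefore admits
  only atomic algebras. The one-element algebra is allowed; its Stone space is empty.
\<close>

definition ultrafilter_on_algebra :: "'b::boolean_algebra set \<Rightarrow> bool" where
  "ultrafilter_on_algebra U \<longleftrightarrow>
     top \<in> U \<and> bot \<notin> U \<and>
     (\<forall>a b. a \<in> U \<longrightarrow> b \<in> U \<longrightarrow> inf a b \<in> U) \<and>
     (\<forall>a b. a \<in> U \<longrightarrow> a \<le> b \<longrightarrow> b \<in> U) \<and>
     (\<forall>a. a \<in> U \<or> - a \<in> U)"

text \<open>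
  The generating sets are closed under finite intersection, hence form a base, and the one
  for \<open>b = top\<close> is the whole space: the points of \<open>stone_space\<close> are exactly the ultrafilters.
\<close>

definition stone_space :: "'b::boolean_algebra set topology" where
  "stone_space =
     topology_generated_by (range (\<lambda>b. {U. ultrafilter_on_algebra U \<and> b \<in> U}))"

text \<open>
  An element of \<open>C(Q)\<close> is represented by its extension by zero outside \<open>topspace Q\<close>. Thus equality,
  order, \<open>0\<close>, \<open>+\<close>, \<open>-\<close> and \<open>*\<close> of elements of \<open>C(Q)\<close> are those of the function type; the constant
  function one of \<open>C(Q)\<close> is \<open>cfun_one Q\<close> and not \<open>1\<close>.
\<close>

definition cfun :: "'a topology \<Rightarrow> ('a \<Rightarrow> real) set" where
  "cfun Q = {f. continuous_map Q euclideanreal f \<and> (\<forall>q. q \<notin> topspace Q \<longrightarrow> f q = 0)}"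

definition cfun_one :: "'a topology \<Rightarrow> 'a \<Rightarrow> real" where
  "cfun_one Q = indicator (topspace Q)"

definition cfun_idempotents :: "'a topology \<Rightarrow> ('a \<Rightarrow> real) set" where
  "cfun_idempotents Q = {e \<in> cfun Q. e * e = e}"

text \<open>
  The supremum is taken among the idempotents; in general it is not the pointwise supremum. It
  exists for every set of idempotents when \<open>Q\<close> is the Stone space of a complete Boolean algebra.
\<close>

definition idempotent_sup :: "'a topology \<Rightarrow> ('a \<Rightarrow> real) set \<Rightarrow> 'a \<Rightarrow> real" where
  "idempotent_sup Q E =
     (THE s. s \<in> cfun_idempotents Q \<and> (\<forall>e\<in>E. e \<le> s) \<and>
             (\<forall>u\<in>cfun_idempotents Q. (\<forall>e\<in>E. e \<le> u) \<longrightarrow> s \<le> u))"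

definition cfun_support :: "'a topology \<Rightarrow> ('a \<Rightarrow> real) \<Rightarrow> 'a \<Rightarrow> real" where
  "cfun_support Q x = cfun_one Q - idempotent_sup Q {e \<in> cfun_idempotents Q. e * x = 0}"

text \<open>Subalgebras need not contain the unit.\<close>

definition cfun_subalgebra :: "'a topology \<Rightarrow> ('a \<Rightarrow> real) set \<Rightarrow> bool" where
  "cfun_subalgebra Q X \<longleftrightarrow>
     X \<subseteq> cfun Q \<and> 0 \<in> X \<and>
     (\<forall>x\<in>X. \<forall>y\<in>X. x + y \<in> X) \<and>
     (\<forall>c. \<forall>x\<in>X. (\<lambda>q. c * x q) \<in> X) \<and>
     (\<forall>x\<in>X. \<forall>y\<in>X. x * y \<in> X)"

definition cfun_ideal :: "'a topology \<Rightarrow> ('a \<Rightarrow> real) set \<Rightarrow> bool" where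
  "cfun_ideal Q X \<longleftrightarrow> cfun_subalgebra Q X \<and> (\<forall>x\<in>cfun Q. \<forall>a\<in>X. x * a \<in> X)"

text \<open>Only the values of \<open>\<delta>\<close> on \<open>X\<close> matter.\<close>

definition cfun_derivation ::
  "('a \<Rightarrow> real) set \<Rightarrow> ('a \<Rightarrow> real) set \<Rightarrow> (('a \<Rightarrow> real) \<Rightarrow> ('a \<Rightarrow> real)) \<Rightarrow> bool" where
  "cfun_derivation X Y \<delta> \<longleftrightarrow>
     (\<forall>x\<in>X. \<delta> x \<in> Y) \<and>
     (\<forall>x\<in>X. \<forall>y\<in>X. \<delta> (x + y) = \<delta> x + \<delta> y) \<and>
     (\<forall>c. \<forall>x\<in>X. \<delta> (\<lambda>q. c * x q) = (\<lambda>q. c * \<delta> x q)) \<and>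
     (\<forall>x\<in>X. \<forall>y\<in>X. \<delta> (x * y) = \<delta> x * y + x * \<delta> y)"

definition band_preserving ::
  "'a topology \<Rightarrow> ('a \<Rightarrow> real) set \<Rightarrow> (('a \<Rightarrow> real) \<Rightarrow> ('a \<Rightarrow> real)) \<Rightarrow> bool" where
  "band_preserving Q X \<delta> \<longleftrightarrow> (\<forall>x\<in>X. cfun_support Q (\<delta> x) \<le> cfun_support Q x)"

end

theory Submission
  imports Defs
begin

text \<open>
  The Leibniz rule alone forces \<open>\<delta> x\<close> to vanish wherever \<open>x\<close> does not. Indeed, let
  \<open>x q \<noteq> 0\<close>. A function \<open>f\<close> vanishing at \<open>q\<close> is a difference of two squares of functions vanishing
  at \<open>q\<close>, and for such a square \<open>h\<^sup>2\<close> the element \<open>(h\<^sup>2 x) x = (h x)\<^sup>2\<close> can be differentiated in two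
  ways; comparison at \<open>q\<close> gives \<open>\<delta> (h\<^sup>2 x) q = 0\<close>, hence \<open>\<delta> (f x) q = 0\<close>. For
  \<open>f = x - x q\<close> this reads \<open>\<delta> (x\<^sup>2) q = x q \<cdot> \<delta> x q\<close>, whereas the Leibniz rule gives
  \<open>2 \<cdot> x q \<cdot> \<delta> x q\<close>, so \<open>\<delta> x q = 0\<close> (lemma \<open>derivation_vanishes_off_zeros\<close>).

  Band preservation excludes the remaining points. If \<open>\<delta> x q \<noteq> 0\<close>, then \<open>\<delta> x \<noteq> 0\<close> on a basic clopen
  neighbourhood of \<open>q\<close>, so that \<open>x = 0\<close> there by the first part. The support of \<open>\<delta> x\<close> is
  one at \<open>q\<close> while that of \<open>x\<close> is zero at \<open>q\<close>, a contradiction. Reading off these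
  values requires that the supremum in the definition of the support exists; this is where
  completeness of the Boolean algebra enters (lemma \<open>idempotents_have_sup\<close>).
\<close>

section \<open>Derivations on ideals of continuous functions\<close>

lemma cfunD: "f \<in> cfun Q \<Longrightarrow> continuous_map Q euclideanreal f"
  and cfun_outside: "f \<in> cfun Q \<Longrightarrow> q \<notin> topspace Q \<Longrightarrow> f q = 0"
  by (auto simp: cfun_def)

lemma cfun_sqrt_pos_part:
  assumes "f \<in> cfun Q"
  shows "(\<lambda>p. sqrt (max (f p) 0)) \<in> cfun Q"
proof -
  have "continuous_map Q euclideanreal (\<lambda>p. max (f p) 0)"
    using cfunD[OF assms] by (intro continuous_map_real_max) auto
  then have "continuous_map Q euclideanreal (\<lambda>p. sqrt (max (f p) 0))"
    by (rule continuous_map_compose[unfolded o_def, of _ _ _ euclideanreal sqrt])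
       (simp add: continuous_on_real_sqrt)
  then show ?thesis
    using cfun_outside[OF assms] by (simp add: cfun_def)
qed

lemma cfun_diff_const:
  assumes "f \<in> cfun Q"
  shows "(\<lambda>p. f p - c * cfun_one Q p) \<in> cfun Q"
proof -
  have "continuous_map Q euclideanreal (\<lambda>p. f p - c)"
    using cfunD[OF assms] by (intro continuous_map_diff) auto
  then have "continuous_map Q euclideanreal (\<lambda>p. f p - c * cfun_one Q p)"
    by (rule continuous_map_eq) (simp add: cfun_one_def)
  then show ?thesis
    using cfun_outside[OF assms] by (simp add: cfun_def cfun_one_def)
qed

lemma cfun_uminus: "f \<in> cfun Q \<Longrightarrow> (\<lambda>p. - f p) \<in> cfun Q"
  by (auto simp: cfun_def intro: continuous_map_minus)

text \<open>
  The factor \<open>x\<close> is needed because \<open>h\<close> itself need not lie in the ideal: the two ways of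
  differentiating \<open>(h\<^sup>2 x) x = (h x) (h x)\<close> involve only members of \<open>X\<close>.
\<close>

lemma derivation_square_multiple:
  assumes X: "cfun_ideal Q X" and D: "cfun_derivation X Y \<delta>"
    and x: "x \<in> X" and q: "x q \<noteq> 0"
    and h: "h \<in> cfun Q" "h q = 0"
  shows "\<delta> (h * h * x) q = 0"
proof -
  have hx: "h * x \<in> X" and hhx: "h * h * x \<in> X"
    using X x h unfolding cfun_ideal_def by (auto simp: mult.assoc)
  have leibniz: "\<delta> (u * v) = \<delta> u * v + u * \<delta> v" if "u \<in> X" "v \<in> X" for u v
    using D that unfolding cfun_derivation_def by blast
  have "\<delta> ((h * h * x) * x) q = \<delta> ((h * x) * (h * x)) q"
    by (simp add: ac_simps)
  then have "\<delta> (h * h * x) q * x q = 0"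
    using leibniz[OF hhx x] leibniz[OF hx hx] h(2) by simp
  then show ?thesis using q by simp
qed

lemma derivation_vanishing_multiple:
  assumes X: "cfun_ideal Q X" and D: "cfun_derivation X Y \<delta>"
    and x: "x \<in> X" and q: "x q \<noteq> 0"
    and f: "f \<in> cfun Q" "f q = 0"
  shows "\<delta> (f * x) q = 0"
proof -
  define h k where "h = (\<lambda>p. sqrt (max (f p) 0))" and "k = (\<lambda>p. sqrt (max (- f p) 0))"
  have hk: "h \<in> cfun Q" "k \<in> cfun Q" "h q = 0" "k q = 0"
    unfolding h_def k_def
    using f cfun_sqrt_pos_part[OF f(1)] cfun_sqrt_pos_part[OF cfun_uminus[OF f(1)]] by auto
  have fhk: "f p + k p * k p = h p * h p" for p
    by (simp add: h_def k_def max_def)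
  have fX: "f * x \<in> X" and kX: "k * k * x \<in> X"
    using X x f hk unfolding cfun_ideal_def by (auto simp: mult.assoc)
  have "h * h * x = f * x + k * k * x"
    using fhk by (auto simp: fun_eq_iff distrib_right[symmetric])
  then have "\<delta> (h * h * x) = \<delta> (f * x) + \<delta> (k * k * x)"
    using D fX kX unfolding cfun_derivation_def by metis
  then show ?thesis
    using derivation_square_multiple[OF X D x q hk(1,3)]
      derivation_square_multiple[OF X D x q hk(2,4)] by simp
qed

text \<open>
  Near \<open>q\<close>, the ideal behaves like the whole algebra, on which there are no nonzero point
  derivations. The constant \<open>x q\<close> is not in the ideal in general, but \<open>x q \<cdot> x\<close> is.
\<close>

lemma derivation_vanishes_off_zeros:
  assumes X: "cfun_ideal Q X" and D: "cfun_derivation X Y \<delta>"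
    and x: "x \<in> X" and q: "x q \<noteq> 0"
  shows "\<delta> x q = 0"
proof -
  have xC: "x \<in> cfun Q"
    using X x unfolding cfun_ideal_def cfun_subalgebra_def by blast
  have qQ: "q \<in> topspace Q"
    using cfun_outside[OF xC] q by blast
  define f where "f = (\<lambda>p. x p - x q * cfun_one Q p)"
  have f: "f \<in> cfun Q" "f q = 0"
    unfolding f_def using cfun_diff_const[OF xC] qQ by (auto simp: cfun_one_def)
  have fX: "f * x \<in> X" and cX: "(\<lambda>p. x q * x p) \<in> X"
    using X x f unfolding cfun_ideal_def cfun_subalgebra_def by auto
  have "x * x = f * x + (\<lambda>p. x q * x p)"
  proof
    fix p
    show "(x * x) p = (f * x + (\<lambda>p. x q * x p)) p"
      using cfun_outside[OF xC, of p]
      by (cases "p \<in> topspace Q") (auto simp: f_def cfun_one_def algebra_simps)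
  qed
  then have "\<delta> (x * x) = \<delta> (f * x) + \<delta> (\<lambda>p. x q * x p)"
    using D fX cX unfolding cfun_derivation_def by metis
  moreover have "\<delta> (\<lambda>p. x q * x p) = (\<lambda>p. x q * \<delta> x p)" "\<delta> (x * x) = \<delta> x * x + x * \<delta> x"
    using D x unfolding cfun_derivation_def by blast+
  ultimately have "(\<delta> x * x + x * \<delta> x) q = (\<delta> (f * x) + (\<lambda>p. x q * \<delta> x p)) q"
    by simp
  then have "\<delta> x q * x q + x q * \<delta> x q = x q * \<delta> x q"
    using derivation_vanishing_multiple[OF X D x q f] by simp
  then show ?thesis using q by simp
qed

section \<open>Ultrafilters and the Stone topology\<close>

text \<open>
  Distinct elements of the algebra define distinct clopen sets because every nonzero element lies in
  an ultrafilter: a maximal proper filter containing it. If neither \<open>c\<close> nor \<open>- c\<close> belonged to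
  a maximal filter \<open>M\<close>, then \<open>M\<close> could be enlarged by \<open>c\<close>; the enlargement is proper because
  \<open>inf m c = bot\<close> with \<open>m \<in> M\<close> would give \<open>m \<le> - c\<close>.
\<close>

lemma ultrafilter_exists:
  fixes a :: "'b::boolean_algebra"
  assumes "a \<noteq> bot"
  obtains U where "ultrafilter_on_algebra U" "a \<in> U"
proof -
  define F :: "'b set set" where
    "F = {M. a \<in> M \<and> bot \<notin> M \<and> (\<forall>u\<in>M. \<forall>v\<in>M. inf u v \<in> M) \<and> (\<forall>u\<in>M. \<forall>v. u \<le> v \<longrightarrow> v \<in> M)}"
  have "{v. a \<le> v} \<in> F"
    using assms unfolding F_def by (auto simp: bot_unique intro: order_trans)
  then have "F \<noteq> {}" by blast
  moreover have "\<Union>C \<in> F" if "C \<noteq> {}" "subset.chain F C" for C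
  proof -
    have CF: "C \<subseteq> F" and lin: "\<And>A B. A \<in> C \<Longrightarrow> B \<in> C \<Longrightarrow> A \<subseteq> B \<or> B \<subseteq> A"
      using that(2) by (auto simp: subset_chain_def)
    have "inf u v \<in> \<Union>C" if uv: "u \<in> \<Union>C" "v \<in> \<Union>C" for u v
    proof -
      obtain A B where AB: "A \<in> C" "u \<in> A" "B \<in> C" "v \<in> B" using uv by blast
      then obtain E where "E \<in> C" "u \<in> E" "v \<in> E" using lin[of A B] by blast
      moreover from this have "inf u v \<in> E" using CF unfolding F_def by blast
      ultimately show ?thesis by blast
    qed
    moreover have "a \<in> \<Union>C" "bot \<notin> \<Union>C"
      using CF that(1) unfolding F_def by blast+
    moreover have "v \<in> \<Union>C" if "u \<in> \<Union>C" "u \<le> v" for u v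
      using CF that unfolding F_def by blast
    ultimately show ?thesis unfolding F_def by blast
  qed
  ultimately obtain M where M: "M \<in> F" and max: "\<And>N. N \<in> F \<Longrightarrow> M \<subseteq> N \<Longrightarrow> N = M"
    using subset_Zorn_nonempty[of F] by blast
  have aM: "a \<in> M" and nb: "bot \<notin> M"
    and infM: "\<And>u v. u \<in> M \<Longrightarrow> v \<in> M \<Longrightarrow> inf u v \<in> M"
    and upM: "\<And>u v. u \<in> M \<Longrightarrow> u \<le> v \<Longrightarrow> v \<in> M"
    using M unfolding F_def by blast+
  have dich: "c \<in> M \<or> - c \<in> M" for c
  proof (rule ccontr)
    assume neg: "\<not> ?thesis"
    define N where "N = {v. \<exists>m\<in>M. inf m c \<le> v}"
    have "bot \<notin> N"
    proof
      assume "bot \<in> N"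
      then obtain m where "m \<in> M" "inf m c = bot"
        unfolding N_def by (auto simp: bot_unique)
      then show False using upM neg inf_shunt by blast
    qed
    moreover have "inf u v \<in> N" if uv: "u \<in> N" "v \<in> N" for u v
    proof -
      obtain m n where mn: "m \<in> M" "inf m c \<le> u" "n \<in> M" "inf n c \<le> v"
        using uv unfolding N_def by blast
      have "inf (inf m n) c \<le> inf m c" "inf (inf m n) c \<le> inf n c"
        by (simp_all add: inf.coboundedI1 le_infI1)
      then have "inf (inf m n) c \<le> inf u v"
        using mn by (meson le_inf_iff order_trans)
      then show ?thesis unfolding N_def using infM mn by blast
    qed
    moreover have MN: "M \<subseteq> N" unfolding N_def using inf_le1 by blast
    ultimately have "N \<in> F"
      unfolding F_def using aM by (auto simp: N_def intro: order_trans)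
    then have "N = M" using max MN by blast
    moreover have "c \<in> N" unfolding N_def using aM by auto
    ultimately show False using neg by blast
  qed
  have "ultrafilter_on_algebra M"
    unfolding ultrafilter_on_algebra_def
    using aM nb infM upM[OF _ top_greatest] upM dich by blast
  then show thesis using that aM by blast
qed

definition stone_clopen :: "'b::boolean_algebra \<Rightarrow> 'b set set" where
  "stone_clopen b = {U. ultrafilter_on_algebra U \<and> b \<in> U}"

lemma openin_stone_clopen: "openin stone_space (stone_clopen b)"
  unfolding stone_space_def stone_clopen_def
  by (rule topology_generated_by_Basis) blast

lemma topspace_stone_space: "topspace stone_space = {U. ultrafilter_on_algebra U}"
proof -
  have "top \<in> U" if "ultrafilter_on_algebra U" for U :: "'a set"
    using that unfolding ultrafilter_on_algebra_def by blast
  then show ?thesis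
    unfolding stone_space_def topology_generated_by_topspace by blast
qed

lemma stone_clopen_inf: "stone_clopen (inf a b) = stone_clopen a \<inter> stone_clopen b"
proof -
  have "inf a b \<in> U \<longleftrightarrow> a \<in> U \<and> b \<in> U" if "ultrafilter_on_algebra U" for U
    using that inf_le1 inf_le2 unfolding ultrafilter_on_algebra_def by meson
  then show ?thesis unfolding stone_clopen_def by blast
qed

lemma stone_clopen_uminus: "stone_clopen (- b) = topspace stone_space - stone_clopen b"
proof -
  have "- b \<notin> U" if U: "ultrafilter_on_algebra U" "b \<in> U" for U
  proof
    assume "- b \<in> U"
    then have "inf b (- b) \<in> U" using U unfolding ultrafilter_on_algebra_def by blast
    then show False using U(1) unfolding ultrafilter_on_algebra_def by simp
  qed
  moreover have "b \<in> U \<or> - b \<in> U" if "ultrafilter_on_algebra U" for U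
    using that unfolding ultrafilter_on_algebra_def by blast
  ultimately show ?thesis
    unfolding topspace_stone_space stone_clopen_def by blast
qed

lemma stone_clopen_mono: "a \<le> b \<Longrightarrow> stone_clopen a \<subseteq> stone_clopen b"
  unfolding stone_clopen_def ultrafilter_on_algebra_def by blast

lemma stone_clopen_empty_iff: "stone_clopen b = {} \<longleftrightarrow> b = bot"
proof
  assume "stone_clopen b = {}"
  then show "b = bot" using ultrafilter_exists[of b] unfolding stone_clopen_def by blast
next
  assume "b = bot"
  then show "stone_clopen b = {}" unfolding stone_clopen_def ultrafilter_on_algebra_def by blast
qed

lemma stone_clopen_base:
  assumes "openin stone_space W" "q \<in> W"
  obtains b where "q \<in> stone_clopen b" "stone_clopen b \<subseteq> W"
proof -
  have "generate_topology_on (range stone_clopen) W"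
    using assms(1) unfolding stone_space_def stone_clopen_def
    by (simp add: openin_topology_generated_by_iff)
  then have "q \<in> W \<Longrightarrow> \<exists>b. q \<in> stone_clopen b \<and> stone_clopen b \<subseteq> W"
  proof (induction rule: generate_topology_on.induct)
    case (Int A B)
    then obtain a b where "q \<in> stone_clopen a" "stone_clopen a \<subseteq> A"
      "q \<in> stone_clopen b" "stone_clopen b \<subseteq> B" by blast
    then show ?case using stone_clopen_inf[of a b] by blast
  next
    case (UN K)
    then obtain k where "k \<in> K" "q \<in> k" by blast
    with UN.IH show ?case by (meson Union_upper order_trans)
  qed auto
  then show thesis using assms(2) that by blast
qed

section \<open>Suprema of idempotents and supports\<close>

lemma idempotent_values:
  assumes "e \<in> cfun_idempotents Q"
  shows "e q = 0 \<or> e q = 1"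
proof -
  have "e q * e q = e q"
    using assms by (metis (mono_tags, lifting) cfun_idempotents_def mem_Collect_eq times_fun_apply)
  then show ?thesis by simp
qed

lemma cfun_open_preimage:
  assumes "f \<in> cfun Q" "open V"
  shows "openin Q {p \<in> topspace Q. f p \<in> V}"
  using openin_continuous_map_preimage[OF cfunD[OF assms(1)]] assms(2) by auto

lemma indicator_clopen_idempotent:
  assumes "openin Q A" "closedin Q A"
  shows "(indicator A :: 'a \<Rightarrow> real) \<in> cfun_idempotents Q"
proof -
  have sub: "A \<subseteq> topspace Q" using assms(1) by (rule openin_subset)
  have "openin Q {p \<in> topspace Q. (indicator A p :: real) \<in> V}" for V
  proof -
    have "{p \<in> topspace Q. (indicator A p :: real) \<in> V} =
        (if 1 \<in> V then A else {}) \<union> (if 0 \<in> V then topspace Q - A else {})"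
      using sub by (auto simp: indicator_def split: if_splits)
    then show ?thesis
      using assms by (simp add: openin_Un openin_diff)
  qed
  then show ?thesis
    using sub unfolding cfun_idempotents_def cfun_def continuous_map_def
    by (auto simp: indicator_def fun_eq_iff)
qed

lemma indicator_stone_clopen:
  "(indicator (stone_clopen b) :: _ \<Rightarrow> real) \<in> cfun_idempotents stone_space"
proof (rule indicator_clopen_idempotent)
  have "stone_clopen b \<subseteq> topspace stone_space"
    unfolding topspace_stone_space stone_clopen_def by blast
  then have "topspace stone_space - stone_clopen (- b) = stone_clopen b"
    by (auto simp: stone_clopen_uminus)
  then show "closedin stone_space (stone_clopen b)"
    using closedin_diff[OF closedin_topspace openin_stone_clopen[of "- b"]] by simp
qed (rule openin_stone_clopen)

definition is_idempotent_sup where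
  "is_idempotent_sup Q E s \<longleftrightarrow>
     s \<in> cfun_idempotents Q \<and> (\<forall>e\<in>E. e \<le> s) \<and>
     (\<forall>u\<in>cfun_idempotents Q. (\<forall>e\<in>E. e \<le> u) \<longrightarrow> s \<le> u)"

text \<open>
  The clopen set of \<open>c\<close>, the supremum in the algebra of all \<open>b\<close> whose clopen sets lie in a
  member of \<open>E\<close>, is the required supremum. An upper bound \<open>u\<close> that is zero somewhere on this clopen
  set would be zero on the nonempty clopen set of some \<open>d\<close> meeting it; then \<open>d\<close> is disjoint from
  every such \<open>b\<close>, so \<open>c \<le> - d\<close>, although the clopen sets of \<open>c\<close> and \<open>d\<close> meet.
\<close>

lemma idempotents_have_sup:
  fixes E :: "('b::{boolean_algebra,complete_lattice} set \<Rightarrow> real) set"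
  assumes E: "E \<subseteq> cfun_idempotents stone_space"
  shows "\<exists>s. is_idempotent_sup stone_space E s"
proof -
  define S :: "'b set" where "S = {b. \<exists>e\<in>E. \<forall>p\<in>stone_clopen b. e p = 1}"
  define s :: "'b set \<Rightarrow> real" where "s = indicator (stone_clopen (Sup S))"
  have upper: "e \<le> s" if e: "e \<in> E" for e
  proof (rule le_funI)
    fix q
    have eI: "e \<in> cfun_idempotents stone_space" using E e by blast
    then have eC: "e \<in> cfun stone_space" by (simp add: cfun_idempotents_def)
    show "e q \<le> s q"
    proof (cases "e q = 0")
      case True
      then show ?thesis by (simp add: s_def)
    next
      case False
      then have q: "q \<in> topspace stone_space" "e q = 1"
        using cfun_outside[OF eC] idempotent_values[OF eI] by blast+
      have "openin stone_space {p \<in> topspace stone_space. e p \<in> - {0}}"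
        by (rule cfun_open_preimage[OF eC]) auto
      then obtain b where b: "q \<in> stone_clopen b"
        "stone_clopen b \<subseteq> {p \<in> topspace stone_space. e p \<in> - {0}}"
        using stone_clopen_base q by force
      have "\<forall>p\<in>stone_clopen b. e p = 1"
        using b(2) idempotent_values[OF eI] by blast
      then have "b \<in> S" unfolding S_def using e by blast
      then have "stone_clopen b \<subseteq> stone_clopen (Sup S)"
        by (intro stone_clopen_mono Sup_upper)
      then show ?thesis using b(1) q by (simp add: s_def subset_iff)
    qed
  qed
  have least: "s \<le> u" if u: "u \<in> cfun_idempotents stone_space" "\<forall>e\<in>E. e \<le> u" for u
  proof (rule le_funI, rule ccontr)
    fix q
    assume "\<not> s q \<le> u q"
    then have q: "q \<in> stone_clopen (Sup S)" and uq: "u q = 0"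
      using idempotent_values[OF u(1), of q] by (auto simp: s_def indicator_def of_bool_def split: if_splits)
    have uC: "u \<in> cfun stone_space" using u by (simp add: cfun_idempotents_def)
    have qQ: "q \<in> topspace stone_space"
      using q openin_subset[OF openin_stone_clopen] by blast
    have "openin stone_space {p \<in> topspace stone_space. u p \<in> - {1}}"
      by (rule cfun_open_preimage[OF uC]) auto
    then obtain d where d: "q \<in> stone_clopen d"
      "stone_clopen d \<subseteq> {p \<in> topspace stone_space. u p \<in> - {1}}"
      using stone_clopen_base qQ uq by force
    have "b \<le> - d" if b: "b \<in> S" for b
    proof -
      obtain e where e: "e \<in> E" "\<forall>p\<in>stone_clopen b. e p = 1"
        using b unfolding S_def by blast
      have "u p = 1" if "p \<in> stone_clopen b" for p
      proof -
        have "1 \<le> u p" using e u(2) that by (metis le_funD)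
        then show ?thesis using idempotent_values[OF u(1), of p] by auto
      qed
      then have "stone_clopen (inf b d) = {}"
        using d(2) by (auto simp: stone_clopen_inf)
      then show ?thesis by (simp add: stone_clopen_empty_iff inf_shunt)
    qed
    then have "Sup S \<le> - d" by (rule Sup_least)
    then have "q \<in> stone_clopen (- d)" using q stone_clopen_mono by blast
    then show False using d(1) by (simp add: stone_clopen_uminus)
  qed
  show ?thesis
    unfolding is_idempotent_sup_def using upper least indicator_stone_clopen[of "Sup S"]
    by (intro exI[of _ s]) (auto simp: s_def)
qed

lemma idempotent_sup_is_sup:
  fixes E :: "('b::{boolean_algebra,complete_lattice} set \<Rightarrow> real) set"
  assumes "E \<subseteq> cfun_idempotents stone_space"
  shows "is_idempotent_sup stone_space E (idempotent_sup stone_space E)"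
proof -
  have "\<exists>!s. is_idempotent_sup stone_space E s"
    using idempotents_have_sup[OF assms]
    by (auto simp: is_idempotent_sup_def intro!: antisym)
  then show ?thesis
    unfolding idempotent_sup_def is_idempotent_sup_def[symmetric] by (rule theI')
qed

text \<open>
  The support is the indicator of the closure of the set of nonzeros of \<open>x\<close>. Only the two
  inequalities that separate the supports of \<open>x\<close> and \<open>\<delta> x\<close> at a point are isolated: one off this
  closure and one on the nonzeros themselves.
\<close>

lemma cfun_support_locally_zero:
  fixes x :: "'b::{boolean_algebra,complete_lattice} set \<Rightarrow> real"
  assumes q: "q \<in> stone_clopen b" and zero: "\<And>p. p \<in> stone_clopen b \<Longrightarrow> x p = 0"
  shows "cfun_support stone_space x q \<le> 0"
proof -
  define E where "E = {e \<in> cfun_idempotents stone_space. e * x = 0}"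
  have sup: "is_idempotent_sup stone_space E (idempotent_sup stone_space E)"
    by (rule idempotent_sup_is_sup) (auto simp: E_def)
  have "indicator (stone_clopen b) * x = 0"
    using zero by (auto simp: fun_eq_iff indicator_def)
  then have "indicator (stone_clopen b) \<in> E"
    using indicator_stone_clopen by (simp add: E_def)
  then have "indicator (stone_clopen b) \<le> idempotent_sup stone_space E"
    using sup unfolding is_idempotent_sup_def by blast
  then have "1 \<le> idempotent_sup stone_space E q"
    using q by (auto simp: le_fun_def dest: spec[of _ q])
  moreover have "cfun_one stone_space q \<le> 1"
    by (simp add: cfun_one_def indicator_def)
  ultimately show ?thesis
    unfolding cfun_support_def E_def[symmetric] by simp
qed

lemma cfun_support_nonzero:
  fixes x :: "'b::{boolean_algebra,complete_lattice} set \<Rightarrow> real"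
  assumes x: "x \<in> cfun stone_space" and q: "x q \<noteq> 0"
  shows "cfun_support stone_space x q \<ge> 1"
proof -
  define E where "E = {e \<in> cfun_idempotents stone_space. e * x = 0}"
  have sup: "is_idempotent_sup stone_space E (idempotent_sup stone_space E)"
    by (rule idempotent_sup_is_sup) (auto simp: E_def)
  have qQ: "q \<in> topspace stone_space" using cfun_outside[OF x] q by blast
  have "openin stone_space {p \<in> topspace stone_space. x p \<in> - {0}}"
    by (rule cfun_open_preimage[OF x]) auto
  then obtain b where b: "q \<in> stone_clopen b"
    "stone_clopen b \<subseteq> {p \<in> topspace stone_space. x p \<in> - {0}}"
    using stone_clopen_base qQ q by force
  \<comment> \<open>The complement of a clopen neighbourhood free of zeros of \<open>x\<close> bounds all annihilators of \<open>x\<close>.\<close>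
  have "e \<le> indicator (stone_clopen (- b))" if e: "e \<in> E" for e
  proof (rule le_funI)
    fix p
    have eI: "e \<in> cfun_idempotents stone_space" and ex: "e p * x p = 0"
      using e by (auto simp: E_def fun_eq_iff)
    have "e p = 0" if "p \<notin> stone_clopen (- b)"
    proof (cases "p \<in> topspace stone_space")
      case True
      then have "x p \<noteq> 0" using that b(2) by (auto simp: stone_clopen_uminus)
      then show ?thesis using ex by simp
    next
      case False
      then show ?thesis using eI cfun_outside by (auto simp: cfun_idempotents_def)
    qed
    then show "e p \<le> indicator (stone_clopen (- b)) p"
      using idempotent_values[OF eI, of p] by (auto simp: indicator_def)
  qed
  then have "idempotent_sup stone_space E \<le> indicator (stone_clopen (- b))"
    using sup indicator_stone_clopen unfolding is_idempotent_sup_def by blast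
  then have "idempotent_sup stone_space E q \<le> indicator (stone_clopen (- b)) q"
    by (rule le_funD)
  then have "idempotent_sup stone_space E q \<le> 0"
    using b(1) by (simp add: stone_clopen_uminus)
  then show ?thesis
    unfolding cfun_support_def E_def[symmetric] using qQ by (simp add: cfun_one_def)
qed

section \<open>Triviality of band preserving derivations\<close>

theorem corollary5p4:
  fixes X Y :: "('b::{boolean_algebra,complete_lattice} set \<Rightarrow> real) set"
    and \<delta> :: "('b set \<Rightarrow> real) \<Rightarrow> ('b set \<Rightarrow> real)"
  assumes "cfun_ideal (stone_space :: 'b set topology) X"
    and "cfun_ideal (stone_space :: 'b set topology) Y"
    and "cfun_derivation X Y \<delta>"
    and "band_preserving (stone_space :: 'b set topology) X \<delta>"
  shows "\<forall>x\<in>X. \<delta> x = 0"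
proof (intro ballI ext, rule ccontr)
  fix x q
  assume x: "x \<in> X" and "\<delta> x q \<noteq> 0 q"
  then have q: "\<delta> x q \<noteq> 0" by simp
  have dC: "\<delta> x \<in> cfun stone_space"
    using assms(2,3) x unfolding cfun_ideal_def cfun_subalgebra_def cfun_derivation_def by blast
  have qQ: "q \<in> topspace stone_space" using cfun_outside[OF dC] q by blast
  have "openin stone_space {p \<in> topspace stone_space. \<delta> x p \<in> - {0}}"
    by (rule cfun_open_preimage[OF dC]) auto
  then obtain b where b: "q \<in> stone_clopen b"
    "stone_clopen b \<subseteq> {p \<in> topspace stone_space. \<delta> x p \<in> - {0}}"
    using stone_clopen_base qQ q by force
  have "x p = 0" if "p \<in> stone_clopen b" for p
    using derivation_vanishes_off_zeros[OF assms(1,3) x, of p] b(2) that by auto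
  then have "cfun_support stone_space x q \<le> 0"
    using cfun_support_locally_zero b(1) by blast
  moreover have "cfun_support stone_space (\<delta> x) q \<ge> 1"
    using cfun_support_nonzero[OF dC q] .
  moreover have "cfun_support stone_space (\<delta> x) q \<le> cfun_support stone_space x q"
    using assms(4) x unfolding band_preserving_def by (blast dest: le_funD)
  ultimately show False by simp
qed

end
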